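(* The circulant graphs $C_{54}(7,11,21,25)$ and $C_{54}(7,11,15,25)$ are isomorphic, but they are neither Type-1 isomorphic nor Type-2 isomorphic with respect to $m=3$.
   Context: For $n\in\mathbb{N}$ and a set $R\subseteq[1,\frac n2]$ of positive integers (jump sizes), $C_n(R)$ is the circulant graph with vertices $v_0,\dots,v_{n-1}$ and edges $(v_i,v_{i+r})$ for $i\in\mathbb{Z}_n$, $r\in R$, subscripts modulo $n$; $C_n(r_1,\dots,r_k)$ means $C_n(\{r_1,\dots,r_k\})$. Reflexive reduction modulo $n$: reduce each integer modulo $n$ and replace any result $r'$ with $r'>\frac n2$ by $n-r'$. Let $\varphi_n$ be the set of integers $x$, taken modulo $n$, with $\gcd(n,x)=1$. For $x\in\varphi_n$, $xR$ denotes the reflexive reduction modulo $n$ of $\{xr: r\in R\}$. Type-1 isomorphism (Adam's isomorphism): $C_n(R)$ and $C_n(S)$ are Type-1 isomorphic if $S=xR$ for some $x\in\varphi_n$. Type-2 isomorphism: let $|R|\ge 3$, $r\in R$, and $m>1$ be such that $m$ divides $\gcd(n,r)$ and $m^3$ divides $n$. Let $K_n$ be the complete graph on $u_0,\dots,u_{n-1}$. For $0\le t\le \frac nm-1$ define the one-to-one map $\theta_{n,m,t}:V(C_n(R))\to V(K_n)$ by $\theta_{n,m,t}(v_x)=u_{x+jtm}$ (subscripts modulo $n$), where $x=qm+j$, $0\le j\le m-1$, $0\le q\le\frac nm-1$. It acts on edges by $\theta_{n,m,t}((v_x,v_{x+s}))=(\theta_{n,m,t}(v_x),\theta_{n,m,t}(v_{x+s}))$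 for $s\in R$, and $\theta_{n,m,t}(C_n(R))$ is the resulting graph on $u_0,\dots,u_{n-1}$. If for some $t$ one has $\theta_{n,m,t}(C_n(R))=C_n(S)$ (the circulant graph on $u_0,\dots,u_{n-1}$) for some $S$ and $S\ne yR$ for all $y\in\varphi_n$, then $C_n(R)$ and $C_n(S)$ are called Type-2 isomorphic with respect to $m$. When $C_n(R)$ and $C_n(S)$ are Type-2 isomorphic with respect to $m$, one also says, for $k\in\mathbb{N}$, that $C_{kn}(kR)$ and $C_{kn}(kS)$ are Type-2 isomorphic with respect to $m$. *)

theory Defs
  imports "Graph_Theory.Graph_Theory" "HOL-Number_Theory.Totient"
begin

text \<open>
  A simple graph is a symmetric loop-free pair digraph (\<^locale>\<open>pair_graph\<close>): an undirected edge
  is the pair of its two orientations. The vertices \<open>v\<^sub>i\<close> (and \<open>u\<^sub>i\<close>) are the residues \<open>i < n\<close>.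
\<close>

definition jump_set :: "nat \<Rightarrow> nat set \<Rightarrow> bool" where
  "jump_set n R \<longleftrightarrow> R \<subseteq> {1..n div 2}"

definition circulant :: "nat \<Rightarrow> nat set \<Rightarrow> nat pair_pre_digraph" where
  "circulant n R =
     \<lparr> pverts = {..<n},
       parcs = (\<Union>i\<in>{..<n}. \<Union>r\<in>R. {(i, (i + r) mod n), ((i + r) mod n, i)}) \<rparr>"

definition refl_red :: "nat \<Rightarrow> nat \<Rightarrow> nat" where
  "refl_red n a = (if 2 * (a mod n) > n then n - a mod n else a mod n)"

definition mult_jumps :: "nat \<Rightarrow> nat \<Rightarrow> nat set \<Rightarrow> nat set" where
  "mult_jumps n x R = (\<lambda>r. refl_red n (x * r)) ` R"

text \<open>The set \<open>\<phi>\<^sub>n\<close> of units modulo \<open>n\<close> is \<^term>\<open>totatives n\<close>.\<close>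

definition type1_isomorphic :: "nat \<Rightarrow> nat set \<Rightarrow> nat set \<Rightarrow> bool" where
  "type1_isomorphic n R S \<longleftrightarrow>
     jump_set n R \<and> jump_set n S \<and> (\<exists>x\<in>totatives n. S = mult_jumps n x R)"

text \<open>For \<open>x = q m + j\<close> with \<open>0 \<le> j < m\<close>, the map sends \<open>x\<close> to \<open>x + j t m\<close> modulo \<open>n\<close>.\<close>

definition theta :: "nat \<Rightarrow> nat \<Rightarrow> nat \<Rightarrow> nat \<Rightarrow> nat" where
  "theta n m t x = (x + (x mod m) * t * m) mod n"

definition image_graph :: "('a \<Rightarrow> 'b) \<Rightarrow> 'a pair_pre_digraph \<Rightarrow> 'b pair_pre_digraph" where
  "image_graph f G = \<lparr> pverts = f ` pverts G, parcs = map_prod f f ` parcs G \<rparr>"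

definition type2_isomorphic_base :: "nat \<Rightarrow> nat \<Rightarrow> nat set \<Rightarrow> nat set \<Rightarrow> bool" where
  "type2_isomorphic_base m n R S \<longleftrightarrow>
     n > 0 \<and> jump_set n R \<and> jump_set n S \<and>
     card R \<ge> 3 \<and> m > 1 \<and> (\<exists>r\<in>R. m dvd gcd n r) \<and> m ^ 3 dvd n \<and>
     (\<exists>t<n div m. image_graph (theta n m t) (circulant n R) = circulant n S) \<and>
     (\<forall>y\<in>totatives n. S \<noteq> mult_jumps n y R)"

text \<open>
  Type-2 isomorphism is also inherited by \<open>C\<^bsub>k n\<^esub>(k R)\<close> and \<open>C\<^bsub>k n\<^esub>(k S)\<close>. As \<open>R\<close> and \<open>S\<close> are
  contained in \<open>[1, n/2]\<close>, the sets \<open>k R\<close> and \<open>k S\<close> need no reduction modulo \<open>k n\<close>.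
\<close>

definition type2_isomorphic :: "nat \<Rightarrow> nat \<Rightarrow> nat set \<Rightarrow> nat set \<Rightarrow> bool" where
  "type2_isomorphic m N R' S' \<longleftrightarrow>
     (\<exists>k n R S. k \<ge> 1 \<and> N = k * n \<and> R' = (*) k ` R \<and> S' = (*) k ` S \<and>
        type2_isomorphic_base m n R S)"

lemma pair_graph_circulant:
  assumes "jump_set n R"
  shows "pair_graph (circulant n R)"
proof -
  have R: "1 \<le> r \<and> r < n" if "r \<in> R" "i < n" for r i
    using assms that by (auto simp: jump_set_def subset_iff)
  have neq: "(i + r) mod n \<noteq> i" if "r \<in> R" "i < n" for i r
    using R[OF that] that by (cases "i + r < n") (auto simp: mod_if)
  have fin: "finite R"
    using assms finite_subset by (auto simp: jump_set_def)
  have sym: "sym (parcs (circulant n R))"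
    by (auto simp: circulant_def sym_def)
  show ?thesis
    using neq fin sym
    by unfold_locales (fastforce simp: circulant_def symmetric_def)+
qed

lemma inj_on_theta:
  assumes "m dvd n"
  shows "inj_on (theta n m t) {..<n}"
proof (rule inj_onI)
  fix x y
  assume xy: "x \<in> {..<n}" "y \<in> {..<n}" and eq: "theta n m t x = theta n m t y"
  have "theta n m t z mod m = z mod m" for z
    using assms by (simp add: theta_def mod_mod_cancel)
  with eq have "x mod m = y mod m" by metis
  with eq have "[x + (x mod m) * t * m = y + (x mod m) * t * m] (mod n)"
    by (simp add: theta_def cong_def)
  then have "[x = y] (mod n)"
    by (simp only: cong_add_rcancel_nat)
  with xy show "x = y" by (simp add: cong_def)
qed

end

theory Submission
  imports Defs
begin

text \<open>
  Modulo 54 the jumps \<open>\<plusminus>7, \<plusminus>11, \<plusminus>25\<close> are exactly the residues congruent to \<open>\<plusminus>7\<close> modulo 18. So the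
  edges that they produce depend on the end points modulo 18 only, and every bijection that fixes
  residues modulo 18 preserves them. This leaves the freedom to add multiples of 18 to the vertices
  so that steps of 21 become steps of \<open>-15\<close>; these two agree modulo 18. Adding \<open>18 * (x div 3)\<close> to
  \<open>x\<close> works: a step of 21 raises \<open>x div 3\<close> by 7, so its image is a step of
  \<open>21 + 18 * 7\<close>, which is \<open>-15\<close> modulo 54 (\<open>shear_step\<close>).

  The graphs are not Type-1 isomorphic because the jump set with 21 contains a jump, 7, together
  with its triple, and this survives multiplication by any \<open>x\<close> (\<open>mult_jumps_multiple\<close>); but no
  jump in \<open>{7, 11, 15, 25}\<close> has its triple in that set: the reduced triples are 21 and 9.

  They are not Type-2 isomorphic for \<open>m = 3\<close> because \<open>\<theta>\<close> fixes all multiples of \<open>m\<close>, hence keeps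
  the edge from 0 to 21, which is missing in the second graph
  (\<open>type2_isomorphic_base_multiple_arc\<close>). Since 7 and 11 are coprime, neither graph arises by
  scaling from a smaller one.
\<close>

section \<open>Arcs of circulant graphs and images of graphs\<close>

lemma circulant_arc_iff:
  "(a, b) \<in> parcs (circulant n R) \<longleftrightarrow>
     a < n \<and> b < n \<and> (\<exists>r\<in>R. [b = a + r] (mod n) \<or> [a = b + r] (mod n))"
  by (auto simp: circulant_def cong_def; metis lessThan_iff)

lemma digraph_iso_image_graph:
  assumes "wf_digraph (with_proj G)" and inj: "inj_on f (pverts G)"
  shows "digraph_iso (with_proj G) (with_proj (image_graph f G))"
proof -
  interpret wf_digraph "with_proj G" by fact
  have sub: "parcs G \<subseteq> pverts G \<times> pverts G"
    using tail_in_verts head_in_verts by force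
  have inj2: "inj_on (map_prod f f) (parcs G)"
    using map_prod_inj_on[OF inj inj] sub inj_on_subset by blast
  let ?h = "\<lparr> iso_verts = f, iso_arcs = map_prod f f, iso_head = snd, iso_tail = fst \<rparr>"
  have "digraph_isomorphism ?h"
    using inj inj2 wf_digraph_axioms by (auto simp: digraph_isomorphism_def)
  moreover have "with_proj (image_graph f G) = app_iso ?h (with_proj G)"
    by (simp add: app_iso_def with_proj_def image_graph_def)
  ultimately show ?thesis
    unfolding digraph_iso_def by blast
qed

section \<open>The isomorphism\<close>

definition shear :: "nat \<Rightarrow> nat" where
  "shear x = (x + 18 * (x div 3)) mod 54"

lemma shear_less: "shear x < 54"
  by (simp add: shear_def)

lemma shear_mod_18: "[shear x = x] (mod 18)"
  by (simp add: shear_def cong_def mod_mod_cancel)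

text \<open>
  Either congruence forces \<open>a\<close> and \<open>b\<close> to agree modulo 3, because the shear fixes residues modulo 3.
  On a class modulo 3 the shear multiplies differences by 7, a unit modulo 18.
\<close>

lemma shear_cong_iff: "[shear a = shear b + 21 * c] (mod 54) \<longleftrightarrow> [a = b + 3 * c] (mod 54)"
proof -
  define p q where "p = a div 3" and "q = b div 3"
  obtain i j where ij: "a = 3 * p + i" "i < 3" "b = 3 * q + j" "j < 3"
    unfolding p_def q_def by (metis mod_less_divisor mult_div_mod_eq zero_less_numeral)
  define d where "d = int p - int q - int c"
  define e where "e = int i - int j"
  have "int a - int (b + 3 * c) = 3 * d + e"
    unfolding d_def e_def ij by simp
  then have dvd_id: "[a = b + 3 * c] (mod 54) \<longleftrightarrow> 54 dvd 3 * d + e"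
    by (simp only: cong_int_iff[symmetric] cong_iff_dvd_diff of_nat_numeral)
  have "int (a + 18 * p) - int (b + 18 * q + 21 * c) = 21 * d + e"
    unfolding d_def e_def ij by simp
  then have "[a + 18 * p = b + 18 * q + 21 * c] (mod 54) \<longleftrightarrow> 54 dvd 21 * d + e"
    by (simp only: cong_int_iff[symmetric] cong_iff_dvd_diff of_nat_numeral)
  then have dvd_shear: "[shear a = shear b + 21 * c] (mod 54) \<longleftrightarrow> 54 dvd 21 * d + e"
    by (simp add: shear_def cong_def mod_simps flip: p_def q_def)
  have "-2 \<le> e" "e \<le> 2"
    using ij unfolding e_def by linarith+
  then have "3 dvd e \<longleftrightarrow> e = 0"
    by presburger
  moreover have "3 dvd e" if "54 dvd 3 * k + e" for k
    using dvd_trans[OF _ that, of 3] by (simp add: dvd_add_right_iff)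
  from this[of d] this[of "7 * d"] have "54 dvd 3 * d + e \<or> 54 dvd 21 * d + e \<Longrightarrow> 3 dvd e"
    by auto
  moreover have "54 dvd 21 * d \<longleftrightarrow> 54 dvd 3 * d"
  proof -
    have *: "54 dvd 3 * k \<longleftrightarrow> 18 dvd k" for k :: int
      using dvd_times_left_cancel_iff[of 3 18 k] by simp
    have "18 dvd 7 * d \<longleftrightarrow> 18 dvd d"
    proof
      \<comment> \<open>The inverse of 7 modulo 18 is 13: \<open>13 * 7 = 1 + 18 * 5\<close>.\<close>
      assume "18 dvd 7 * d"
      then have "18 dvd 13 * (7 * d) - 18 * (5 * d)"
        by (intro dvd_diff dvd_mult[of _ _ 13]) simp_all
      then show "18 dvd d" by simp
    qed (rule dvd_mult)
    then show ?thesis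
      using *[of d] *[of "7 * d"] by simp
  qed
  ultimately show ?thesis
    unfolding dvd_id dvd_shear by auto
qed

lemma shear_step: "[shear a = shear b + 15] (mod 54) \<longleftrightarrow> [b = a + 21] (mod 54)"
proof -
  \<comment> \<open>A step of 21 from \<open>a\<close> to \<open>b\<close> is a step of \<open>33 = 3 * 11\<close> back, and \<open>21 * 11\<close> is 15 modulo 54.\<close>
  have "[b = a + 21] (mod 54) \<longleftrightarrow> [b + 33 = a + 21 + 33] (mod 54)"
    by (simp only: cong_add_rcancel_nat)
  also have "\<dots> \<longleftrightarrow> [a = b + 33] (mod 54)"
    by (simp add: cong_def eq_commute)
  also have "\<dots> \<longleftrightarrow> [shear a = shear b + 231] (mod 54)"
    using shear_cong_iff[of a b 11] by simp
  also have "\<dots> \<longleftrightarrow> [shear a = shear b + 15] (mod 54)"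
    using mod_add_cong[of "shear b" 54 "shear b" 231 15] by (simp add: cong_def)
  finally show ?thesis ..
qed

lemma bij_betw_shear: "bij_betw shear {..<54} {..<54}"
proof -
  have "inj_on shear {..<54}"
  proof (rule inj_onI)
    fix x y assume "x \<in> {..<54}" "y \<in> {..<54}" "shear x = shear y"
    then have "[x = y] (mod 54)" "x < 54" "y < 54"
      using shear_cong_iff[of x y 0] by simp_all
    then show "x = y"
      by (simp add: cong_less_modulus_unique_nat)
  qed
  moreover have "shear ` {..<54} \<subseteq> {..<54}"
    using shear_less by auto
  ultimately show ?thesis
    by (simp add: bij_betw_def endo_inj_surj)
qed

lemma dvd_18_iff_54: "18 dvd u \<longleftrightarrow> 54 dvd u \<or> 54 dvd u - 18 \<or> 54 dvd u + 18" for u :: int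
proof
  assume "18 dvd u"
  then obtain v where u: "u = 18 * v" ..
  have *: "54 dvd 18 * w \<longleftrightarrow> 3 dvd w" for w :: int
    using dvd_times_left_cancel_iff[of 18 3 w] by simp
  have "3 dvd v \<or> 3 dvd v - 1 \<or> 3 dvd v + 1"
    by presburger
  then show "54 dvd u \<or> 54 dvd u - 18 \<or> 54 dvd u + 18"
    using *[of v] *[of "v - 1"] *[of "v + 1"] by (simp add: u algebra_simps)
next
  have *: "18 dvd w" if "54 dvd w" for w :: int
    using dvd_trans[OF _ that, of 18] by simp
  assume "54 dvd u \<or> 54 dvd u - 18 \<or> 54 dvd u + 18"
  then show "18 dvd u"
    using *[of u] *[of "u - 18"] *[of "u + 18"]
      dvd_diff[of 18 "u + 18" 18] dvd_add[of 18 "u - 18" 18] by auto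
qed

text \<open>
  The three lifts of 7 from modulo 18 to modulo 54 are 7, 25 and 43, and a step of 43 is a step of
  11 backwards. This is why \<open>\<plusminus>7, \<plusminus>11, \<plusminus>25\<close> together form a set of jumps that is
  defined modulo 18.
\<close>

lemma cong_18_iff_54:
  fixes c d :: nat
  shows "[d = c + 7] (mod 18) \<longleftrightarrow>
         [d = c + 7] (mod 54) \<or> [d = c + 25] (mod 54) \<or> [c = d + 11] (mod 54)"
proof -
  define u where "u = int d - int c - 7"
  have "[d = c + 7] (mod 18) \<longleftrightarrow> 18 dvd u" "[d = c + 7] (mod 54) \<longleftrightarrow> 54 dvd u"
    "[d = c + 25] (mod 54) \<longleftrightarrow> 54 dvd u - 18"
    unfolding u_def by (simp_all add: cong_int_iff[symmetric] cong_iff_dvd_diff algebra_simps)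
  moreover have "[c = d + 11] (mod 54) \<longleftrightarrow> 54 dvd u + 18"
  proof -
    have "int c - int (d + 11) = - (u + 18)"
      by (simp add: u_def)
    then show ?thesis
      by (simp only: cong_int_iff[symmetric] cong_iff_dvd_diff dvd_minus_iff of_nat_numeral)
  qed
  ultimately show ?thesis
    by (simp only: dvd_18_iff_54)
qed

lemma circulant_54_arc_iff:
  "(a, b) \<in> parcs (circulant 54 {7, 11, s, 25}) \<longleftrightarrow>
     a < 54 \<and> b < 54 \<and> ([b = a + 7] (mod 18) \<or> [a = b + 7] (mod 18) \<or>
       [b = a + s] (mod 54) \<or> [a = b + s] (mod 54))"
proof -
  have bex: "(\<exists>r\<in>{7, 11, s, 25}. P r) \<longleftrightarrow> P 7 \<or> P 11 \<or> P s \<or> P 25" for P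
    by simp
  show ?thesis
    unfolding circulant_arc_iff bex cong_18_iff_54 by argo
qed

lemma shear_arc_iff:
  assumes "a < 54" "b < 54"
  shows "(shear a, shear b) \<in> parcs (circulant 54 {7, 11, 15, 25}) \<longleftrightarrow>
         (a, b) \<in> parcs (circulant 54 {7, 11, 21, 25})"
proof -
  have "[shear d = shear c + 7] (mod 18) \<longleftrightarrow> [d = c + 7] (mod 18)" for c d
    using shear_mod_18[of d] cong_add[OF shear_mod_18[of c] cong_refl[of 7]]
    by (simp only: cong_def)
  then show ?thesis
    using assms unfolding circulant_54_arc_iff shear_step by (simp add: shear_less) blast
qed

lemma image_shear_circulant:
  "image_graph shear (circulant 54 {7, 11, 21, 25}) = circulant 54 {7, 11, 15, 25}"
proof -
  let ?G = "circulant 54 {7, 11, 21, 25}" and ?H = "circulant 54 {7, 11, 15, 25}"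
  have surj: "\<exists>x<54. y = shear x" if "y < 54" for y
    using that bij_betw_shear unfolding bij_betw_def by (metis imageE lessThan_iff)
  have "map_prod shear shear ` parcs ?G = parcs ?H"
  proof (intro equalityI subsetI)
    fix e assume "e \<in> map_prod shear shear ` parcs ?G"
    then obtain a b where "e = (shear a, shear b)" and ab: "(a, b) \<in> parcs ?G"
      by auto
    moreover from ab have "a < 54" "b < 54"
      by (simp_all only: circulant_arc_iff)
    ultimately show "e \<in> parcs ?H"
      by (simp only: shear_arc_iff)
  next
    fix e assume e: "e \<in> parcs ?H"
    then obtain u v where uv: "e = (u, v)" "u < 54" "v < 54"
      by (metis circulant_arc_iff surj_pair)
    then obtain a b where "a < 54" "b < 54" "u = shear a" "v = shear b"
      using surj by blast
    with e uv have "(a, b) \<in> parcs ?G" "e = map_prod shear shear (a, b)"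
      by (simp_all only: shear_arc_iff map_prod_simp)
    then show "e \<in> map_prod shear shear ` parcs ?G"
      by blast
  qed
  then show ?thesis
    using bij_betw_shear by (simp add: image_graph_def circulant_def bij_betw_def)
qed

section \<open>Obstruction to Type-1 isomorphism\<close>

lemma refl_red_neg:
  assumes "n dvd a + b"
  shows "refl_red n a = refl_red n b"
proof (cases "n = 0")
  case False
  have "n dvd a mod n + b mod n"
    using assms by (simp add: dvd_eq_mod_eq_0 mod_add_eq)
  then obtain k where k: "a mod n + b mod n = n * k" ..
  have "a mod n < n" "b mod n < n"
    using False by simp_all
  then have "n * k < n * 2"
    using k by linarith
  then have "k = 0 \<or> k = 1"
    by auto
  with k have "a mod n + b mod n = 0 \<or> a mod n + b mod n = n"
    by auto
  then show ?thesis
    by (auto simp: refl_red_def)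
qed (use assms in \<open>simp add: refl_red_def\<close>)

lemma refl_red_mult: "refl_red n (k * refl_red n a) = refl_red n (k * a)"
proof (cases "2 * (a mod n) > n \<and> n > 0")
  case True
  have "n dvd k * (n - a mod n + a)"
  proof -
    have "n - a mod n + a = n + n * (a div n)"
      using mod_less_divisor[of n a] mult_div_mod_eq[of n a] True by linarith
    then show ?thesis by (simp add: dvd_mult)
  qed
  then have "refl_red n (k * (n - a mod n)) = refl_red n (k * a)"
    by (intro refl_red_neg) (simp add: distrib_left)
  with True show ?thesis
    by (simp add: refl_red_def[of n a])
next
  case False
  then show ?thesis
    by (cases "n = 0") (auto simp: refl_red_def mod_mult_right_eq)
qed

text \<open>
  Reduction only changes signs modulo \<open>n\<close>, so reducing before
  taking a multiple does not alter the reduced multiple. Hence having a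
  jump together with its \<open>k\<close>-fold is an invariant of Type-1 isomorphism.
\<close>

lemma mult_jumps_multiple:
  assumes "r \<in> R" "k * r \<in> R"
  shows "\<exists>s\<in>mult_jumps n x R. refl_red n (k * s) \<in> mult_jumps n x R"
proof
  show "refl_red n (x * r) \<in> mult_jumps n x R"
    using assms by (simp add: mult_jumps_def)
  have "refl_red n (k * refl_red n (x * r)) = refl_red n (x * (k * r))"
    by (simp add: refl_red_mult mult.left_commute)
  then show "refl_red n (k * refl_red n (x * r)) \<in> mult_jumps n x R"
    using assms by (simp add: mult_jumps_def)
qed

lemma not_type1_isomorphic_54:
  "\<not> type1_isomorphic 54 {7, 11, 21, 25} {7, 11, 15, 25}"
proof
  assume "type1_isomorphic 54 {7, 11, 21, 25} {7, 11, 15, 25}"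
  then obtain x where x: "{7, 11, 15, 25} = mult_jumps 54 x {7, 11, 21, 25}"
    by (auto simp: type1_isomorphic_def)
  have "\<exists>s\<in>{7, 11, 15, 25}. refl_red 54 (3 * s) \<in> {7, 11, 15, 25}"
    unfolding x by (rule mult_jumps_multiple[where r = 7]) simp_all
  then show False
    by (simp add: refl_red_def)
qed

section \<open>Obstruction to Type-2 isomorphism\<close>

text \<open>
  Whatever \<open>t\<close> is, \<open>\<theta>\<close> moves \<open>x\<close> by a multiple of \<open>x mod m\<close>, so it fixes both 0 and every
  jump divisible by \<open>m\<close>; the edge between them survives.
\<close>

lemma type2_isomorphic_base_multiple_arc:
  assumes "type2_isomorphic_base m n R S" "r \<in> R" "m dvd r"
  shows "(0, r) \<in> parcs (circulant n S)"
proof -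
  obtain t where R: "jump_set n R" "n > 0"
    and im: "image_graph (theta n m t) (circulant n R) = circulant n S"
    using assms(1) by (auto simp: type2_isomorphic_base_def)
  have "r < n"
    using R assms(2) by (auto simp: jump_set_def subset_iff)
  then have "(0, r) \<in> parcs (circulant n R)"
    using assms(2) by (auto simp: circulant_arc_iff intro!: bexI[of _ r])
  moreover have "theta n m t 0 = 0" "theta n m t r = r"
    using assms(3) \<open>r < n\<close> by (simp_all add: theta_def)
  ultimately have "(0, r) \<in> map_prod (theta n m t) (theta n m t) ` parcs (circulant n R)"
    by (metis image_eqI map_prod_simp)
  with im show ?thesis
    by (metis image_graph_def pair_pre_digraph.select_convs(2))
qed

lemma not_type2_isomorphic_54:
  "\<not> type2_isomorphic 3 54 {7, 11, 21, 25} {7, 11, 15, 25}"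
proof
  assume "type2_isomorphic 3 54 {7, 11, 21, 25} {7, 11, 15, 25}"
  then obtain k n R S where k: "54 = k * n" "{7, 11, 21, 25} = (*) k ` R"
      "{7, 11, 15, 25} = (*) k ` S" and base: "type2_isomorphic_base 3 n R S"
    unfolding type2_isomorphic_def by blast
  have "7 \<in> (*) k ` R" "11 \<in> (*) k ` R"
    unfolding k(2)[symmetric] by simp_all
  then have "k dvd gcd 7 11"
    by (intro gcd_greatest) (auto intro: dvdI[OF sym])
  then have "k = 1"
    by (simp add: gcd_nat.simps)
  with k base have "type2_isomorphic_base 3 54 {7, 11, 21, 25} {7, 11, 15, 25}"
    by simp
  from type2_isomorphic_base_multiple_arc[OF this, of 21] show False
    by (simp add: circulant_arc_iff cong_def)
qed

theorem mainTheorem2: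
  shows "digraph_iso (with_proj (circulant 54 {7, 11, 21, 25}))
                     (with_proj (circulant 54 {7, 11, 15, 25})) \<and>
         \<not> type1_isomorphic 54 {7, 11, 21, 25} {7, 11, 15, 25} \<and>
         \<not> type2_isomorphic 3 54 {7, 11, 21, 25} {7, 11, 15, 25}"
proof (intro conjI not_type1_isomorphic_54 not_type2_isomorphic_54)
  let ?G = "circulant 54 {7, 11, 21, 25}"
  interpret pair_graph ?G
    by (rule pair_graph_circulant) (simp add: jump_set_def)
  have "inj_on shear (pverts ?G)"
    using bij_betw_shear by (simp add: circulant_def bij_betw_def)
  from digraph_iso_image_graph[OF wf_digraph_axioms this]
  show "digraph_iso (with_proj ?G) (with_proj (circulant 54 {7, 11, 15, 25}))"
    by (simp only: image_shear_circulant)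
qed

end
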